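(* There exists an inter-class orthogonal plan for a $3^3$ experiment on six blocks of size four each estimating all main effects and all two-factor interactions.
   Context: $F=\{0,1,2\}$ is the field of order $3$. A run of a $3^m$ experiment is a vector $x\in F^m$ ($x_i$ is the level of the $i$th factor). A plan consists of a list of blocks, each a list of runs. For $a\in F^m\setminus\{0\}$, $E_a$ denotes the factorial effect given by $a$, with $E_a=E_{2a}$; run $x$ is at level $t$ of $E_a$ if $a'x=t$. $E_a$ is a main effect if $a$ has exactly one non-zero entry, and a two-factor interaction if $a$ has exactly two non-zero entries (so $A_iA_j$ and $A_iA_j^2$ count as two different two-factor interactions, each with 2 degrees of freedom). All interactions involving three or more factors are assumed absent. Orthogonality through the block factor (all blocks of size $k$): $E_a$ and $E_b$ are orthogonal if $kN^{ab}=L^a(L^b)'$, where $N^{ab}$ has $(\alpha,\beta)$ entry the number of runs $x$ of the plan with $a'x=\alpha$, $b'x=\beta$, and $L^a$ has $(\alpha,j)$ entry the number of runs $x$ in block $j$ with $a'x=\alpha$. A plan is inter-class orthogonal if the set of all effects of interest (here: all main effects and two-factor interactions) can be divided into several classes such that every effect is orthogonal (through the block factor) to every effect from a different class. A plan estimates a set $S$ of effects if, in the linear model in which the expected response of a run $x$ in block $j$ is $\mu+\beta_j+\sum_{E_a\in S}\theta^a_{a'x}$ (general effect, block effects, and effects of the levels of the members of $S$), every contrast $\sum_{t\in F} l_t\theta^a_t$ with $\sum_t l_t=0$, $E_a\in S$, is estimable. *)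

theory Defs
  imports "HOL-Analysis.Cartesian_Space" "HOL-Library.Numeral_Type"
    "HOL-Library.Disjoint_Sets"
begin

text \<open>
  The type \<open>3\<close> of \<^theory>\<open>HOL-Library.Numeral_Type\<close> carries arithmetic modulo 3.  The library
  only makes it a commutative ring, but every nonzero element is its own inverse, so it is the
  field of order 3.
\<close>

type_synonym F = "3"

lemma F_UNIV: "(UNIV :: F set) = {0, 1, 2}"
proof -
  have "(3 :: F) = 0" by simp
  then show ?thesis using UNIV_3 by auto
qed

lemma F_nonzero_self_inverse: "x \<noteq> 0 \<Longrightarrow> x * x = 1" for x :: F
proof -
  assume "x \<noteq> 0"
  moreover have "x \<in> {0, 1, 2}" using F_UNIV by blast
  ultimately show ?thesis by auto
qed

type_synonym 'm run = "F ^ 'm"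

text \<open>Blocks are lists, so that a run may be repeated within a block.\<close>

type_synonym 'm plan = "'m run list list"

definition level :: "F ^ 'm::finite \<Rightarrow> 'm run \<Rightarrow> F" where
  "level a x = (\<Sum>i\<in>UNIV. a $ i * x $ i)"

text \<open>
  An effect is represented by the set of its (two) defining vectors, which makes
  \<open>effect a = effect (2 *s a)\<close> hold literally.
\<close>

definition effect :: "F ^ 'm::finite \<Rightarrow> (F ^ 'm) set" where
  "effect a = {a, 2 *s a}"

definition main_effects :: "(F ^ 'm::finite) set set" where
  "main_effects = {effect a |a. card {i. a $ i \<noteq> 0} = 1}"

definition two_factor_interactions :: "(F ^ 'm::finite) set set" where
  "two_factor_interactions = {effect a |a. card {i. a $ i \<noteq> 0} = 2}"

definition N_count :: "'m::finite plan \<Rightarrow> F ^ 'm \<Rightarrow> F ^ 'm \<Rightarrow> F \<Rightarrow> F \<Rightarrow> nat" where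
  "N_count P a b \<alpha> \<beta> = length (filter (\<lambda>x. level a x = \<alpha> \<and> level b x = \<beta>) (concat P))"

definition L_count :: "'m::finite plan \<Rightarrow> F ^ 'm \<Rightarrow> F \<Rightarrow> nat \<Rightarrow> nat" where
  "L_count P a \<alpha> j = length (filter (\<lambda>x. level a x = \<alpha>) (P ! j))"

definition orthogonal_vecs :: "nat \<Rightarrow> 'm::finite plan \<Rightarrow> F ^ 'm \<Rightarrow> F ^ 'm \<Rightarrow> bool" where
  "orthogonal_vecs k P a b \<longleftrightarrow>
     (\<forall>\<alpha> \<beta>. k * N_count P a b \<alpha> \<beta> = (\<Sum>j<length P. L_count P a \<alpha> j * L_count P b \<beta> j))"

text \<open>
  Orthogonality through the block factor, for plans whose blocks all have size \<open>k\<close>.  Replacing a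
  vector by its double only permutes its levels, so it is immaterial which representatives are
  used.
\<close>

definition orthogonal_effects ::
    "nat \<Rightarrow> 'm::finite plan \<Rightarrow> (F ^ 'm) set \<Rightarrow> (F ^ 'm) set \<Rightarrow> bool" where
  "orthogonal_effects k P E G \<longleftrightarrow> (\<forall>a\<in>E. \<forall>b\<in>G. orthogonal_vecs k P a b)"

text \<open>At least two classes are required: with a single class the condition would be vacuous.\<close>

definition inter_class_orthogonal ::
    "nat \<Rightarrow> 'm::finite plan \<Rightarrow> (F ^ 'm) set set \<Rightarrow> bool" where
  "inter_class_orthogonal k P S \<longleftrightarrow>
     (\<exists>\<C>. partition_on S \<C> \<and> 2 \<le> card \<C> \<and>
        (\<forall>X\<in>\<C>. \<forall>Y\<in>\<C>. X \<noteq> Y \<longrightarrow> (\<forall>E\<in>X. \<forall>G\<in>Y. orthogonal_effects k P E G)))"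

text \<open>
  The function \<open>rep\<close> chooses for each effect in the model the vector \<open>a\<close> whose values
  \<open>level a x\<close> label its levels.
\<close>

definition expected_response ::
    "((F ^ 'm::finite) set \<Rightarrow> F ^ 'm) \<Rightarrow> (F ^ 'm) set set \<Rightarrow>
      real \<Rightarrow> (nat \<Rightarrow> real) \<Rightarrow> ((F ^ 'm) set \<Rightarrow> F \<Rightarrow> real) \<Rightarrow> nat \<Rightarrow> 'm run \<Rightarrow> real" where
  "expected_response rep S \<mu> \<beta> \<theta> j x = \<mu> + \<beta> j + (\<Sum>E\<in>S. \<theta> E (level (rep E) x))"

text \<open>
  A parametric function is estimable if some linear combination of the responses, with
  coefficient \<open>c j i\<close> for run \<open>i\<close> of block \<open>j\<close>, is an unbiased estimator of it, that is, has it
  as its expectation for all parameter values.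
\<close>

definition estimable ::
    "'m::finite plan \<Rightarrow> ((F ^ 'm) set \<Rightarrow> F ^ 'm) \<Rightarrow> (F ^ 'm) set set \<Rightarrow>
      (real \<Rightarrow> (nat \<Rightarrow> real) \<Rightarrow> ((F ^ 'm) set \<Rightarrow> F \<Rightarrow> real) \<Rightarrow> real) \<Rightarrow> bool" where
  "estimable P rep S \<psi> \<longleftrightarrow>
     (\<exists>c :: nat \<Rightarrow> nat \<Rightarrow> real. \<forall>\<mu> \<beta> \<theta>.
        (\<Sum>j<length P. \<Sum>i<length (P ! j). c j i * expected_response rep S \<mu> \<beta> \<theta> j (P ! j ! i))
          = \<psi> \<mu> \<beta> \<theta>)"

definition estimates :: "'m::finite plan \<Rightarrow> (F ^ 'm) set set \<Rightarrow> bool" where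
  "estimates P S \<longleftrightarrow>
     (\<forall>rep. (\<forall>E\<in>S. rep E \<in> E) \<longrightarrow>
        (\<forall>E\<in>S. \<forall>l :: F \<Rightarrow> real. (\<Sum>t\<in>UNIV. l t) = 0 \<longrightarrow>
           estimable P rep S (\<lambda>\<mu> \<beta> \<theta>. \<Sum>t\<in>UNIV. l t * \<theta> E t)))"

end

theory Submission
  imports Defs
begin

text \<open>
  Take two blocks of size four together with their translates by \<open>t = (1,1,1)\<close> and \<open>2t\<close>.  An
  effect \<open>E\<^sub>a\<close> with \<open>a't = 0\<close> is then orthogonal to every effect \<open>E\<^sub>b\<close> with \<open>b't \<noteq> 0\<close>, whatever the
  two blocks are.  This gives the classes \<open>{AB\<^sup>2, AC\<^sup>2, BC\<^sup>2}\<close> and \<open>{A, B, C, AB, AC, BC}\<close>.  The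
  model is saturated, with 6 + 9 * 2 = 24 free parameters for 24 runs, so only the nonsingularity
  of the design matrix depends on the two blocks; for the pair below its inverse, which holds the
  coefficients of the estimators, has entries with denominator 9 only.
\<close>

section \<open>Levels over the field of order 3\<close>

lemma level_add: "level a (x + y) = level a x + level a y"
  by (simp add: level_def distrib_left sum.distrib)

lemma level_scale_left: "level (c *s a) x = c * level a x"
  by (simp add: level_def sum_distrib_left mult.assoc)

lemma level_scale_right: "level a (c *s x) = c * level a x"
  by (simp add: level_def sum_distrib_left mult.left_commute)

lemma F_cases: "(x :: F) = 0 \<or> x = 1 \<or> x = 2"
  using F_UNIV by blast

lemma F_all: "(\<forall>x :: F. Q x) \<longleftrightarrow> Q 0 \<and> Q 1 \<and> Q 2"
  by (metis F_cases)

lemma F_numerals: "(3::F) = 0" "(4::F) = 1" "(5::F) = 2" "(6::F) = 0" "(7::F) = 1" "(8::F) = 2"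
  by simp_all

lemma sum_F: "sum f (UNIV :: F set) = f 0 + f 1 + f 2" for f :: "F \<Rightarrow> 'a::comm_monoid_add"
  unfolding F_UNIV by (simp add: add.assoc)

lemma F_double_eq_0: "2 * x = 0 \<longleftrightarrow> x = 0" for x :: F
  using F_cases[of x] by auto

section \<open>Orthogonality from translation invariance\<close>

definition translates :: "'m::finite run \<Rightarrow> 'm plan \<Rightarrow> 'm plan" where
  "translates t Bs = Bs @ map (map ((+) t)) Bs @ map (map ((+) (2 *s t))) Bs"

lemma sum_list_translates:
  "sum_list (map f (translates t Bs))
     = (\<Sum>B\<leftarrow>Bs. f B + f (map ((+) t) B) + f (map ((+) (2 *s t)) B))"
  for f :: "_ \<Rightarrow> nat"
  by (simp add: translates_def sum_list_addf comp_def)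

text \<open>The elements 0, \<open>c\<close> and \<open>2 * c\<close> exhaust the field, so each
  member of \<open>B\<close> satisfying \<open>Q\<close> passes exactly one of the three
  filters.\<close>

lemma length_filter_shifts:
  fixes f :: "'a \<Rightarrow> F"
  assumes "c \<noteq> 0"
  shows "length (filter (\<lambda>x. Q x \<and> f x = \<beta>) B) + length (filter (\<lambda>x. Q x \<and> c + f x = \<beta>) B)
           + length (filter (\<lambda>x. Q x \<and> 2 * c + f x = \<beta>) B) = length (filter Q B)"
proof (induction B)
  case (Cons x B)
  have "of_bool (f x = \<beta>) + of_bool (c + f x = \<beta>) + of_bool (2 * c + f x = \<beta>) = (1::nat)"
    using assms F_cases[of c] F_cases[of "f x"] F_cases[of \<beta>] by auto
  with Cons show ?case
    by (auto split: if_splits)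
qed simp

text \<open>Written as list sums, both sides can be split along the translates by
  \<open>sum_list_translates\<close>.\<close>

lemma orthogonal_vecs_sum_list:
  "orthogonal_vecs k P a b \<longleftrightarrow>
     (\<forall>\<alpha> \<beta>. k * (\<Sum>B\<leftarrow>P. length (filter (\<lambda>x. level a x = \<alpha> \<and> level b x = \<beta>) B))
        = (\<Sum>B\<leftarrow>P. length (filter (\<lambda>x. level a x = \<alpha>) B) * length (filter (\<lambda>x. level b x = \<beta>) B)))"
  by (simp add: orthogonal_vecs_def N_count_def L_count_def filter_concat length_concat comp_def
      sum_list_sum_nth[of "map _ _"] atLeast0LessThan)

lemma orthogonal_vecs_commute: "orthogonal_vecs k P a b \<Longrightarrow> orthogonal_vecs k P b a"
  by (simp add: orthogonal_vecs_sum_list conj_commute mult.commute)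

text \<open>
  Translation by \<open>t\<close> fixes the levels of \<open>a\<close> and permutes those of \<open>b\<close> cyclically, so summing
  over the three translates of a block makes the levels of \<open>b\<close> equally frequent.
\<close>

lemma orthogonal_vecs_translates:
  assumes k: "\<forall>B\<in>set Bs. length B = k" and a: "level a t = 0" and b: "level b t \<noteq> 0"
  shows "orthogonal_vecs k (translates t Bs) a b"
  unfolding orthogonal_vecs_sum_list sum_list_translates
proof (intro allI)
  fix \<alpha> \<beta>
  define n where "n B = length (filter (\<lambda>x. level a x = \<alpha>) B)" for B
  define m where "m B = length (filter (\<lambda>x. level b x = \<beta>) B)" for B
  define p where "p B = length (filter (\<lambda>x. level a x = \<alpha> \<and> level b x = \<beta>) B)" for B
  have p: "p B + p (map ((+) t) B) + p (map ((+) (2 *s t)) B) = n B" for B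
    using length_filter_shifts[OF b, of "\<lambda>x. level a x = \<alpha>" "level b" \<beta> B]
    by (simp add: p_def n_def filter_map comp_def level_add level_scale_right a)
  have m: "m B + m (map ((+) t) B) + m (map ((+) (2 *s t)) B) = length B" for B
    using length_filter_shifts[OF b, of "\<lambda>_. True" "level b" \<beta> B]
    by (simp add: m_def filter_map comp_def level_add level_scale_right)
  have n: "n (map ((+) t) B) = n B" "n (map ((+) (2 *s t)) B) = n B" for B
    by (simp_all add: n_def filter_map comp_def level_add level_scale_right a)
  have "k * (\<Sum>B\<leftarrow>Bs. p B + p (map ((+) t) B) + p (map ((+) (2 *s t)) B)) = (\<Sum>B\<leftarrow>Bs. n B * k)"
    by (simp add: p sum_list_const_mult mult.commute)
  also have "\<dots> = (\<Sum>B\<leftarrow>Bs. n B * (m B + m (map ((+) t) B) + m (map ((+) (2 *s t)) B)))"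
    using k by (intro arg_cong[of _ _ sum_list] map_cong) (auto simp: m)
  also have "\<dots> = (\<Sum>B\<leftarrow>Bs. n B * m B + n (map ((+) t) B) * m (map ((+) t) B)
      + n (map ((+) (2 *s t)) B) * m (map ((+) (2 *s t)) B))"
    by (simp add: n distrib_left)
  finally show "k * (\<Sum>B\<leftarrow>Bs. p B + p (map ((+) t) B) + p (map ((+) (2 *s t)) B)) = \<dots>" .
qed

text \<open>Doubling a vector preserves whether its level at \<open>t\<close> vanishes, so this
  property sorts effects into two classes; \<open>a\<close> and \<open>b\<close> make both
  non-empty.\<close>

lemma inter_class_orthogonal_translates:
  assumes k: "\<forall>B\<in>set Bs. length B = k" and S: "S \<subseteq> range effect"
    and a: "effect a \<in> S" "level a t = 0" and b: "effect b \<in> S" "level b t \<noteq> 0"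
  shows "inter_class_orthogonal k (translates t Bs) S"
proof -
  define X where "X = {E \<in> S. \<forall>a\<in>E. level a t = 0}"
  define Y where "Y = {E \<in> S. \<forall>a\<in>E. level a t \<noteq> 0}"
  have "effect a \<in> X" "effect b \<in> Y"
    using a b by (auto simp: X_def Y_def effect_def level_scale_left F_double_eq_0)
  \<comment> \<open>Only the empty set could satisfy both conditions, and
    \<open>S \<subseteq> range effect\<close> excludes it.\<close>
  moreover have "X \<inter> Y = {}"
    using S by (force simp: X_def Y_def effect_def)
  moreover have "S = X \<union> Y"
    using S by (auto simp: X_def Y_def effect_def level_scale_left F_double_eq_0)
  ultimately have "partition_on S {X, Y}" "X \<noteq> Y"
    by (auto simp: partition_on_def disjoint_def)
  moreover have "orthogonal_effects k (translates t Bs) E G" "orthogonal_effects k (translates t Bs) G E"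
    if "E \<in> X" "G \<in> Y" for E G
    using that k
    by (auto simp: orthogonal_effects_def X_def Y_def
        intro: orthogonal_vecs_translates orthogonal_vecs_commute[OF orthogonal_vecs_translates])
  ultimately show ?thesis
    unfolding inter_class_orthogonal_def by (intro exI[of _ "{X, Y}"]) auto
qed

section \<open>Estimability from isolating weights\<close>

text \<open>
  The value \<open>g u - (\<Sum>t\<in>UNIV. g t) / 3\<close> is the deviation of level \<open>u\<close> from the mean.  The
  values \<open>g u\<close> themselves are not estimable, being determined only up to a common constant.
\<close>

lemma estimates_if_isolating:
  fixes P :: "'m::finite plan"
  assumes R: "finite R" "inj_on effect R"
    and isolating: "\<And>a u. a \<in> R \<Longrightarrow> \<exists>w :: nat \<Rightarrow> nat \<Rightarrow> real.
      (\<forall>j<length P. (\<Sum>i<length (P ! j). w j i) = 0) \<and>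
      (\<forall>b\<in>R. \<forall>g. (\<Sum>j<length P. \<Sum>i<length (P ! j). w j i * g (level b (P ! j ! i)))
        = (if b = a then g u - (\<Sum>t\<in>UNIV. g t) / 3 else 0))"
  shows "estimates P (effect ` R)"
  unfolding estimates_def
proof (intro allI impI ballI)
  fix rep :: "(F ^ 'm) set \<Rightarrow> F ^ 'm" and E and l :: "F \<Rightarrow> real"
  assume rep: "\<forall>E\<in>effect ` R. rep E \<in> E" and "E \<in> effect ` R" and l: "(\<Sum>t\<in>UNIV. l t) = 0"
  then obtain a where a: "a \<in> R" "E = effect a" by blast
  \<comment> \<open>\<open>rep\<close> may pick \<open>b\<close> or its double; \<open>s b\<close>
    is the scalar relating the two. Since 1 and 2 are self-inverse, multiplication by it is an
    involution of the levels.\<close>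
  define s :: "F ^ 'm \<Rightarrow> F" where "s b = (if rep (effect b) = b then 1 else 2)" for b
  have s: "level (rep (effect b)) x = s b * level b x" if "b \<in> R" for b x
  proof -
    have "rep (effect b) = s b *s b"
      using rep that by (auto simp: s_def effect_def)
    then show ?thesis by (simp add: level_scale_left)
  qed
  have ss: "s a * (s a * u) = u" for u
    using F_cases[of u] by (auto simp: s_def)
  have reindex: "(\<Sum>u\<in>UNIV. f (s a * u)) = (\<Sum>u\<in>UNIV. f u)" for f :: "F \<Rightarrow> real"
    by (rule sum.reindex_bij_witness[of _ "(*) (s a)" "(*) (s a)"]) (auto simp: ss)
  from isolating[OF a(1)] have "\<forall>u. \<exists>w :: nat \<Rightarrow> nat \<Rightarrow> real.
      (\<forall>j<length P. (\<Sum>i<length (P ! j). w j i) = 0) \<and>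
      (\<forall>b\<in>R. \<forall>g. (\<Sum>j<length P. \<Sum>i<length (P ! j). w j i * g (level b (P ! j ! i)))
        = (if b = a then g u - (\<Sum>t\<in>UNIV. g t) / 3 else 0))" ..
  then obtain w :: "F \<Rightarrow> nat \<Rightarrow> nat \<Rightarrow> real" where
    w0: "\<And>u j. j < length P \<Longrightarrow> (\<Sum>i<length (P ! j). w u j i) = 0" and
    w: "\<And>u b g. b \<in> R \<Longrightarrow> (\<Sum>j<length P. \<Sum>i<length (P ! j). w u j i * g (level b (P ! j ! i)))
        = (if b = a then g u - (\<Sum>t\<in>UNIV. g t) / 3 else 0)"
    unfolding choice_iff by blast
  \<comment> \<open>\<open>w u\<close> isolates level \<open>u\<close> of \<open>a\<close>, which is
    level \<open>s a * u\<close> of the chosen representative; hence this coefficient of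
    \<open>l\<close>.\<close>
  define c where "c j i = (\<Sum>u\<in>UNIV. l (s a * u) * w u j i)" for j i
  have "(\<Sum>j<length P. \<Sum>i<length (P ! j). c j i * expected_response rep (effect ` R) \<mu> \<beta> \<theta> j (P ! j ! i))
      = (\<Sum>t\<in>UNIV. l t * \<theta> E t)" for \<mu> \<beta> \<theta>
  proof -
    define y where "y j i = expected_response rep (effect ` R) \<mu> \<beta> \<theta> j (P ! j ! i)" for j i
    have y: "y j i = \<mu> + \<beta> j + (\<Sum>b\<in>R. \<theta> (effect b) (s b * level b (P ! j ! i)))" for j i
      by (simp add: y_def expected_response_def sum.reindex[OF R(2)] s)
    have wy: "(\<Sum>j<length P. \<Sum>i<length (P ! j). w u j i * y j i)
        = \<theta> E (s a * u) - (\<Sum>t\<in>UNIV. \<theta> E t) / 3" for u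
    proof -
      \<comment> \<open>Weights summing to zero on each block eliminate the general and block
        effects.\<close>
      have "(\<Sum>j<length P. \<Sum>i<length (P ! j). w u j i * y j i)
          = (\<Sum>j<length P. (\<mu> + \<beta> j) * (\<Sum>i<length (P ! j). w u j i))
            + (\<Sum>j<length P. \<Sum>i<length (P ! j).
                w u j i * (\<Sum>b\<in>R. \<theta> (effect b) (s b * level b (P ! j ! i))))"
        unfolding sum_distrib_left[of "\<mu> + \<beta> _"] sum.distrib[symmetric]
        by (intro sum.cong refl) (simp add: y algebra_simps)
      also have "(\<Sum>j<length P. (\<mu> + \<beta> j) * (\<Sum>i<length (P ! j). w u j i)) = 0"
        by (simp add: w0)
      also have "(\<Sum>j<length P. \<Sum>i<length (P ! j).
            w u j i * (\<Sum>b\<in>R. \<theta> (effect b) (s b * level b (P ! j ! i))))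
          = (\<Sum>b\<in>R. \<Sum>j<length P. \<Sum>i<length (P ! j).
            w u j i * \<theta> (effect b) (s b * level b (P ! j ! i)))"
        by (simp only: sum_distrib_left sum.swap[of _ R])
      also have "\<dots> = (\<Sum>b\<in>R. if b = a then \<theta> E (s a * u) - (\<Sum>t\<in>UNIV. \<theta> E (s a * t)) / 3 else 0)"
        by (intro sum.cong) (auto simp: a(2) w[where g = "\<lambda>v. \<theta> (effect b) (s b * v)" for b])
      finally show ?thesis
        using R(1) a(1) by (simp add: reindex)
    qed
    have "(\<Sum>j<length P. \<Sum>i<length (P ! j). c j i * y j i)
        = (\<Sum>j<length P. \<Sum>i<length (P ! j). \<Sum>u\<in>UNIV. l (s a * u) * (w u j i * y j i))"
      by (simp add: c_def sum_distrib_right mult.assoc)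
    also have "\<dots> = (\<Sum>u\<in>UNIV. l (s a * u) * (\<Sum>j<length P. \<Sum>i<length (P ! j). w u j i * y j i))"
      by (simp add: sum_F sum.distrib sum_distrib_left)
    also have "\<dots> = (\<Sum>u\<in>UNIV. l u * (\<theta> E u - (\<Sum>t\<in>UNIV. \<theta> E t) / 3))"
      unfolding wy by (rule reindex)
    \<comment> \<open>The mean over the levels will cancel because \<open>l\<close> sums to
      zero.\<close>
    also have "\<dots> = (\<Sum>u\<in>UNIV. l u * \<theta> E u) - (\<Sum>u\<in>UNIV. l u) * ((\<Sum>t\<in>UNIV. \<theta> E t) / 3)"
      unfolding sum_distrib_right by (simp add: right_diff_distrib sum_subtractf)
    finally show ?thesis by (simp add: l y_def)
  qed
  then show "estimable P rep (effect ` R) (\<lambda>\<mu> \<beta> \<theta>. \<Sum>t\<in>UNIV. l t * \<theta> E t)"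
    unfolding estimable_def by blast
qed

section \<open>The plan\<close>

abbreviation vec3 :: "F \<Rightarrow> F \<Rightarrow> F \<Rightarrow> F ^ 3" where
  "vec3 x y z \<equiv> vector [x, y, z]"

lemma vec3_add: "vec3 a b c + vec3 x y z = vec3 (a + x) (b + y) (c + z)"
  by (simp add: vec_eq_iff forall_3)

lemma vec3_scale: "k *s vec3 x y z = vec3 (k * x) (k * y) (k * z)"
  by (simp add: vec_eq_iff forall_3)

lemma vec3_eq_iff: "vec3 a b c = vec3 x y z \<longleftrightarrow> a = x \<and> b = y \<and> c = z"
  by (auto simp: vec_eq_iff forall_3)

lemma vec3_cases: obtains x y z where "v = vec3 x y z"
proof
  show "v = vec3 (v $ 1) (v $ 2) (v $ 3)" by (simp add: vec_eq_iff forall_3)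
qed

lemma level_vec3: "level (vec3 a b c) (vec3 x y z) = a * x + b * y + c * z"
  by (simp add: level_def sum_3)

lemma card_support_vec3:
  "card {i. vec3 x y z $ i \<noteq> 0} = of_bool (x \<noteq> 0) + of_bool (y \<noteq> 0) + of_bool (z \<noteq> 0)"
proof -
  have "card {i. vec3 x y z $ i \<noteq> 0} = (\<Sum>i\<in>UNIV. of_bool (vec3 x y z $ i \<noteq> 0))"
    by (simp add: of_bool_def sum.If_cases)
  then show ?thesis by (simp add: sum_3)
qed

text \<open>One vector per effect: the first six have level 1 at (1,1,1), the last three level
  0.\<close>

definition effect_vectors :: "(F ^ 3) set" where
  "effect_vectors = {vec3 1 0 0, vec3 0 1 0, vec3 0 0 1, vec3 2 2 0, vec3 2 0 2, vec3 0 2 2,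
     vec3 1 2 0, vec3 1 0 2, vec3 0 1 2}"

lemma inj_on_effect_vectors: "inj_on effect effect_vectors"
  by (auto simp: inj_on_def effect_vectors_def effect_def vec3_scale doubleton_eq_iff vec3_eq_iff)

lemma effects_eq: "main_effects \<union> two_factor_interactions = effect ` effect_vectors"
proof (intro equalityI subsetI)
  fix E :: "(F ^ 3) set" assume "E \<in> main_effects \<union> two_factor_interactions"
  then obtain a where E: "E = effect a"
      and a: "card {i. a $ i \<noteq> 0} = 1 \<or> card {i. a $ i \<noteq> 0} = 2"
    by (auto simp: main_effects_def two_factor_interactions_def)
  obtain x y z where xyz: "a = vec3 x y z" by (rule vec3_cases)
  \<comment> \<open>A check of all 27 vectors, enumerated by \<open>F_all\<close>.\<close>
  have "\<forall>x y z. card {i. vec3 x y z $ i \<noteq> 0} = 1 \<or> card {i. vec3 x y z $ i \<noteq> 0} = 2 \<longrightarrow>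
      vec3 x y z \<in> effect_vectors \<or> 2 *s vec3 x y z \<in> effect_vectors"
    unfolding card_support_vec3 by (simp add: F_all effect_vectors_def vec3_scale vec3_eq_iff)
  with a have "a \<in> effect_vectors \<or> 2 *s a \<in> effect_vectors"
    unfolding xyz by blast
  moreover have "effect (2 *s a) = effect a"
    by (auto simp: effect_def xyz vec3_scale F_numerals)
  ultimately show "E \<in> effect ` effect_vectors"
    unfolding E by (metis imageI)
next
  fix E assume "E \<in> effect ` effect_vectors"
  then obtain a where "E = effect a" "a \<in> effect_vectors" by blast
  moreover from this have "card {i. a $ i \<noteq> 0} = 1 \<or> card {i. a $ i \<noteq> 0} = 2"
    by (auto simp: effect_vectors_def card_support_vec3)
  ultimately show "E \<in> main_effects \<union> two_factor_interactions"
    by (auto simp: main_effects_def two_factor_interactions_def)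
qed

definition base_blocks :: "3 plan" where
  "base_blocks = [[vec3 0 0 0, vec3 0 0 1, vec3 0 0 2, vec3 0 2 1],
                  [vec3 0 1 2, vec3 0 2 1, vec3 0 2 2, vec3 1 0 1]]"

text \<open>The blocks form consecutive pairs for the shifts 0, t, 2t; the weight tables are
  concatenated in this order.\<close>

definition the_plan :: "3 plan" where
  "the_plan = translates (vec3 1 1 1) base_blocks"

section \<open>Explicit weight tables and their verification\<close>

definition weighted_sum :: "real list list \<Rightarrow> 'a list list \<Rightarrow> ('a \<Rightarrow> real) \<Rightarrow> real" where
  "weighted_sum W P f = (\<Sum>(ws, B)\<leftarrow>zip W P. \<Sum>(w, x)\<leftarrow>zip ws B. w * f x)"

lemma sum_list_zip_nth:
  assumes "length xs = length ys"
  shows "(\<Sum>(x, y)\<leftarrow>zip xs ys. f x y) = (\<Sum>i<length ys. f (xs ! i) (ys ! i))"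
  using assms by (simp add: sum_list_sum_nth atLeast0LessThan)

lemma weighted_sum_nth:
  assumes "map length W = map length P"
  shows "weighted_sum W P f = (\<Sum>j<length P. \<Sum>i<length (P ! j). W ! j ! i * f (P ! j ! i))"
proof -
  have len: "length W = length P" using assms by (rule map_eq_imp_length_eq)
  have "length (W ! j) = length (P ! j)" if "j < length P" for j
    using assms that len by (metis nth_map)
  then show ?thesis
    unfolding weighted_sum_def sum_list_zip_nth[OF len] by (simp add: sum_list_zip_nth)
qed

lemma weighted_sum_map: "weighted_sum W (map (map h) P) f = weighted_sum W P (\<lambda>x. f (h x))"
  by (simp add: weighted_sum_def zip_map2 case_prod_unfold comp_def)

text \<open>The weights are scaled by 9 to make all table entries integers.\<close>

definition isolates :: "real list list \<Rightarrow> F ^ 3 \<Rightarrow> F \<Rightarrow> bool" where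
  "isolates W a u \<longleftrightarrow> map length W = [4, 4, 4, 4, 4, 4] \<and> (\<forall>ws\<in>set W. sum_list ws = 0) \<and>
     (\<forall>b\<in>effect_vectors. \<forall>g. weighted_sum W (map (map (level b)) the_plan) g
        = (if b = a then 9 * g u - 3 * (\<Sum>t\<in>UNIV. g t) else 0))"

lemma the_plan_levels:
  "map (map (level (vec3 1 0 0))) the_plan =
     [[0, 0, 0, 0], [0, 0, 0, 1], [1, 1, 1, 1], [1, 1, 1, 2], [2, 2, 2, 2], [2, 2, 2, 0]]"
  "map (map (level (vec3 0 1 0))) the_plan =
     [[0, 0, 0, 2], [1, 2, 2, 0], [1, 1, 1, 0], [2, 0, 0, 1], [2, 2, 2, 1], [0, 1, 1, 2]]"
  "map (map (level (vec3 0 0 1))) the_plan =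
     [[0, 1, 2, 1], [2, 1, 2, 1], [1, 2, 0, 2], [0, 2, 0, 2], [2, 0, 1, 0], [1, 0, 1, 0]]"
  "map (map (level (vec3 2 2 0))) the_plan =
     [[0, 0, 0, 1], [2, 1, 1, 2], [1, 1, 1, 2], [0, 2, 2, 0], [2, 2, 2, 0], [1, 0, 0, 1]]"
  "map (map (level (vec3 2 0 2))) the_plan =
     [[0, 2, 1, 2], [1, 2, 1, 1], [1, 0, 2, 0], [2, 0, 2, 2], [2, 1, 0, 1], [0, 1, 0, 0]]"
  "map (map (level (vec3 0 2 2))) the_plan =
     [[0, 2, 1, 0], [0, 0, 2, 2], [1, 0, 2, 1], [1, 1, 0, 0], [2, 1, 0, 2], [2, 2, 1, 1]]"
  "map (map (level (vec3 1 2 0))) the_plan =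
     [[0, 0, 0, 1], [2, 1, 1, 1], [0, 0, 0, 1], [2, 1, 1, 1], [0, 0, 0, 1], [2, 1, 1, 1]]"
  "map (map (level (vec3 1 0 2))) the_plan =
     [[0, 2, 1, 2], [1, 2, 1, 0], [0, 2, 1, 2], [1, 2, 1, 0], [0, 2, 1, 2], [1, 2, 1, 0]]"
  "map (map (level (vec3 0 1 2))) the_plan =
     [[0, 2, 1, 1], [2, 1, 0, 2], [0, 2, 1, 1], [2, 1, 0, 2], [0, 2, 1, 1], [2, 1, 0, 2]]"
  by (simp_all add: the_plan_def translates_def base_blocks_def level_vec3 vec3_add vec3_scale F_numerals)

text \<open>
  Translation by \<open>t\<close> raises the level of the effects with \<open>a't = 1\<close> by one, so their three weight
  tables arise from each other by permuting the translates; to get \<open>a't = 1\<close>, the vectors of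
  \<open>AB\<close>, \<open>AC\<close>, \<open>BC\<close> are taken with entries 2 rather than 1.  The tables of the effects with
  \<open>a't = 0\<close> agree on all translates.
\<close>

definition isolates_cyclically ::
    "F ^ 3 \<Rightarrow> real list list \<Rightarrow> real list list \<Rightarrow> real list list \<Rightarrow> bool" where
  "isolates_cyclically a X Y Z \<longleftrightarrow>
     isolates (X @ Y @ Z) a 0 \<and> isolates (Z @ X @ Y) a 1 \<and> isolates (Y @ Z @ X) a 2"

definition isolates_uniformly ::
    "F ^ 3 \<Rightarrow> real list list \<Rightarrow> real list list \<Rightarrow> real list list \<Rightarrow> bool" where
  "isolates_uniformly a X Y Z \<longleftrightarrow>
     isolates (X @ X @ X) a 0 \<and> isolates (Y @ Y @ Y) a 1 \<and> isolates (Z @ Z @ Z) a 2"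

lemmas isolates_simps =
  isolates_def effect_vectors_def the_plan_levels weighted_sum_def sum_F vec3_eq_iff

text \<open>On explicit level tables the condition for all \<open>g\<close> is a linear identity in
  \<open>g 0\<close>, \<open>g 1\<close>, \<open>g 2\<close>, settled by comparing
  coefficients.\<close>

lemma isolates_cyclically:
  "isolates_cyclically (vec3 1 0 0)
     [[-1, 4, -1, -2], [2, 0, 1, -3]]
     [[2, -2, -1, 1], [-1, 0, 1, 0]]
     [[-1, -2, 2, 1], [-1, 0, -2, 3]]"
  "isolates_cyclically (vec3 0 1 0)
     [[0, 0, 2, -2], [-1, 2, -1, 0]]
     [[0, 0, -1, 1], [-1, -1, 2, 0]]
     [[0, 0, -1, 1], [2, -1, -1, 0]]"
  "isolates_cyclically (vec3 0 0 1)
     [[2, -1, -1, 0], [0, 0, 0, 0]]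
     [[-1, -1, 2, 0], [0, 0, 0, 0]]
     [[-1, 2, -1, 0], [0, 0, 0, 0]]"
  "isolates_cyclically (vec3 2 2 0)
     [[0, 1, 1, -2], [-1, 1, 0, 0]]
     [[0, 1, -2, 1], [2, -2, 0, 0]]
     [[0, -2, 1, 1], [-1, 1, 0, 0]]"
  "isolates_cyclically (vec3 2 0 2)
     [[2, 0, -2, 0], [0, -1, 1, 0]]
     [[-1, 0, 1, 0], [0, 2, -2, 0]]
     [[-1, 0, 1, 0], [0, -1, 1, 0]]"
  "isolates_cyclically (vec3 0 2 2)
     [[0, -1, 1, 0], [0, 1, -1, 0]]
     [[0, 2, -2, 0], [0, -2, 2, 0]]
     [[0, -1, 1, 0], [0, 1, -1, 0]]"
  by (simp_all add: isolates_cyclically_def isolates_simps)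

lemma isolates_uniformly:
  "isolates_uniformly (vec3 1 2 0)
     [[0, 1, 1, -2], [-1, 1, 0, 0]]
     [[-1, 0, 0, 1], [-1, -1, 1, 1]]
     [[1, -1, -1, 1], [2, 0, -1, -1]]"
  "isolates_uniformly (vec3 1 0 2)
     [[1, -1, 0, 0], [0, 0, -1, 1]]
     [[-1, 0, 1, 0], [0, -1, 1, 0]]
     [[0, 1, -1, 0], [0, 1, 0, -1]]"
  "isolates_uniformly (vec3 0 1 2)
     [[1, 0, -1, 0], [0, 0, 1, -1]]
     [[0, -1, 1, 0], [0, 1, -1, 0]]
     [[-1, 1, 0, 0], [0, -1, 0, 1]]"
  by (simp_all add: isolates_uniformly_def isolates_simps)

lemma isolating_weights:
  assumes "a \<in> effect_vectors"
  obtains W where "isolates W a u"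
  using assms F_cases[of u] isolates_cyclically isolates_uniformly
  unfolding effect_vectors_def isolates_cyclically_def isolates_uniformly_def by blast

lemma length_the_plan: "map length the_plan = [4, 4, 4, 4, 4, 4]"
  by (simp add: the_plan_def translates_def base_blocks_def)

lemma estimates_the_plan: "estimates the_plan (effect ` effect_vectors)"
proof (rule estimates_if_isolating)
  show "finite effect_vectors" by (simp add: effect_vectors_def)
  show "inj_on effect effect_vectors" by (rule inj_on_effect_vectors)
  fix a u assume "a \<in> effect_vectors"
  then obtain W where W: "isolates W a u" by (rule isolating_weights)
  have len: "map length W = map length the_plan"
    using W by (simp add: isolates_def length_the_plan)
  then have "length W = length the_plan" by (rule map_eq_imp_length_eq)
  have "(\<Sum>i<length (the_plan ! j). W ! j ! i) = 0" if "j < length the_plan" for j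
  proof -
    have "length (W ! j) = length (the_plan ! j)" "W ! j \<in> set W"
      using len that \<open>length W = length the_plan\<close> by (metis nth_map, metis nth_mem)
    with W show ?thesis
      by (auto simp: isolates_def sum_list_sum_nth atLeast0LessThan)
  qed
  moreover have "(\<Sum>j<length the_plan. \<Sum>i<length (the_plan ! j).
        W ! j ! i * g (level b (the_plan ! j ! i)))
      = (if b = a then 9 * g u - 3 * (\<Sum>t\<in>UNIV. g t) else 0)" if "b \<in> effect_vectors" for b g
    using W that weighted_sum_nth[OF len, of "\<lambda>x. g (level b x)"]
    by (simp add: isolates_def weighted_sum_map)
  ultimately show "\<exists>w :: nat \<Rightarrow> nat \<Rightarrow> real.
      (\<forall>j<length the_plan. (\<Sum>i<length (the_plan ! j). w j i) = 0) \<and>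
      (\<forall>b\<in>effect_vectors. \<forall>g.
        (\<Sum>j<length the_plan. \<Sum>i<length (the_plan ! j). w j i * g (level b (the_plan ! j ! i)))
          = (if b = a then g u - (\<Sum>t\<in>UNIV. g t) / 3 else 0))"
    \<comment> \<open>Division by 9 undoes the scaling in \<open>isolates\<close>.\<close>
    by (intro exI[of _ "\<lambda>j i. W ! j ! i / 9"])
      (simp add: sum_divide_distrib[symmetric] diff_divide_distrib)
qed

theorem theorem5p1:
  shows "\<exists>P :: 3 plan. length P = 6 \<and> (\<forall>B\<in>set P. length B = 4) \<and>
           inter_class_orthogonal 4 P (main_effects \<union> two_factor_interactions) \<and>
           estimates P (main_effects \<union> two_factor_interactions)"
proof (intro exI conjI)
  show "length the_plan = 6" "\<forall>B\<in>set the_plan. length B = 4"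
    by (simp_all add: the_plan_def translates_def base_blocks_def)
  show "inter_class_orthogonal 4 the_plan (main_effects \<union> two_factor_interactions)"
    unfolding the_plan_def effects_eq
    \<comment> \<open>\<open>AB\<^sup>2\<close> and \<open>A\<close> witness that both classes are
      non-empty.\<close>
    by (rule inter_class_orthogonal_translates[of _ _ _ "vec3 1 2 0" _ "vec3 1 0 0"])
      (auto simp: base_blocks_def effect_vectors_def level_vec3)
  show "estimates the_plan (main_effects \<union> two_factor_interactions)"
    unfolding effects_eq by (rule estimates_the_plan)
qed

end
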